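(* Let $P$ be a finite poset with a minimum element $\hat{0}$, let $m$ be a positive integer such that $\mathcal{L}_m(P)\neq\emptyset$, and suppose $P$ has a branch with $k$ elements, where $1\le k\le m-2$. Consider the action of $\partial_K$ on $\mathcal{L}_m(P)$. (a) $m-1$ divides the order $o(\partial_K)$ of $\partial_K$ as a permutation of $\mathcal{L}_m(P)$. (b) If $\gcd(k,m-1)=1$, then $m-1$ divides the size of every orbit of $\partial_K$ on $\mathcal{L}_m(P)$.
   Context: For a positive integer $m$, $[m]=\{1,\dots,m\}$. An $m$-packed labeling of a finite poset $P$ is a surjection $L:P\to[m]$ such that $x<_P y$ implies $L(x)<L(y)$; $\mathcal{L}_m(P)$ is the set of all of them. $K$-promotion $\partial_K:\mathcal{L}_m(P)\to\mathcal{L}_m(P)$ is defined as follows. Given $L$, erase the labels of all elements labeled $1$. Then for $i=2,3,\dots,m$ in turn: for every cover relation $x\lessdot y$ such that $x$ is currently unlabeled and $y$ currently has label $i$, give $x$ the label $i$ and erase the label of $y$ (all such pairs processed simultaneously; other elements unchanged). Finally decrease every existing label by $1$ and give label $m$ to every unlabeled element. This is a bijection of $\mathcal{L}_m(P)$; its orbits are the orbits of the cyclic group it generates. The principal subposets of $P$ are the connected components (in the Hasse diagram) of $P-\{\hat 0\}$; a branch is a principal subposet which is a chain. *)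

theory Defs
  imports
    "HOL-Algebra.Multiplicative_Group"
    "HOL-Algebra.Generated_Groups"
    "HOL-Algebra.Group_Action"
begin

definition packed_labelings :: "nat \<Rightarrow> ('a::order \<Rightarrow> nat) set" where
  "packed_labelings m = {L. range L = {1..m} \<and> (\<forall>x y. x < y \<longrightarrow> L x < L y)}"

text \<open>The cover relation of the subposet induced on \<open>A\<close>.\<close>
definition covers_in :: "'a::order set \<Rightarrow> 'a \<Rightarrow> 'a \<Rightarrow> bool" where
  "covers_in A x y \<longleftrightarrow> x \<in> A \<and> y \<in> A \<and> x < y \<and> \<not> (\<exists>z\<in>A. x < z \<and> z < y)"

text \<open>
  A partial labeling is a map into \<^typ>\<open>nat option\<close>, where \<^const>\<open>None\<close> means unlabeled.
  Both tests in \<open>slide i f\<close> refer to the old labeling \<open>f\<close>, so all covers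
  \<open>x \<lessdot> y\<close> with \<open>x\<close> unlabeled and \<open>y\<close> labeled \<open>i\<close> are processed simultaneously.
\<close>
definition slide :: "nat \<Rightarrow> ('a::order \<Rightarrow> nat option) \<Rightarrow> ('a \<Rightarrow> nat option)" where
  "slide i f = (\<lambda>z.
     if f z = None \<and> (\<exists>y. covers_in UNIV z y \<and> f y = Some i) then Some i
     else if f z = Some i \<and> (\<exists>x. covers_in UNIV x z \<and> f x = None) then None
     else f z)"

definition K_promotion :: "nat \<Rightarrow> ('a::order \<Rightarrow> nat) \<Rightarrow> ('a \<Rightarrow> nat)" where
  "K_promotion m L =
     (let f = fold slide [2..<Suc m] (\<lambda>z. if L z = 1 then None else Some (L z))
      in (\<lambda>z. case f z of None \<Rightarrow> m | Some j \<Rightarrow> j - 1))"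

text \<open>
  The elements of \<^const>\<open>BijGroup\<close> are extensional functions; hence the restriction to
  the packed labelings.
\<close>
definition K_promotion_perm :: "nat \<Rightarrow> ('a::order \<Rightarrow> nat) \<Rightarrow> ('a \<Rightarrow> nat)" where
  "K_promotion_perm m = restrict (K_promotion m) (packed_labelings m)"

text \<open>The orbits of the cyclic group generated by \<^const>\<open>K_promotion_perm\<close>, acting tautologically.\<close>
definition K_promotion_orbits :: "nat \<Rightarrow> ('a::order \<Rightarrow> nat) set set" where
  "K_promotion_orbits m =
     orbits (subgroup_generated (BijGroup (packed_labelings m)) {K_promotion_perm m})
       (packed_labelings m) (\<lambda>g. g)"

definition hasse_adj :: "'a::order set \<Rightarrow> 'a rel" where
  "hasse_adj A = {(x, y). covers_in A x y \<or> covers_in A y x}"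

definition principal_subposets :: "'a::order_bot set set" where
  "principal_subposets = (- {bot}) // (hasse_adj (- {bot}))\<^sup>*"

definition is_branch :: "'a::order_bot set \<Rightarrow> bool" where
  "is_branch B \<longleftrightarrow> B \<in> principal_subposets \<and> Complete_Partial_Order.chain (\<le>) B"

end

theory Submission
  imports Defs "HOL-Combinatorics.Transposition"
begin

text \<open>
  K-promotion is the composite of the K-Bender-Knuth involutions that exchange the labels
  \<open>j\<close> and \<open>j + 1\<close> wherever this is allowed, for \<open>j = 1, \<dots>, m - 1\<close> in this order; hence it is a
  bijection. The first involution is trivial because \<open>bot\<close> is the only element labeled 1.
  On a branch the others act on the set of labels as adjacent transpositions, so promotion rotates
  the set of branch labels cyclically in \<open>{2..m}\<close>. The sum of these labels modulo \<open>m - 1\<close>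
  controls the orbit sizes, and a labeling whose branch labels form an interval gives the order.
\<close>

section \<open>K-Bender-Knuth involutions\<close>

text \<open>For strictly monotone \<open>g\<close>, exactly the isolated elements of the subposet
  labeled \<open>j\<close> or \<open>Suc j\<close> change their label. The order relation can
  replace the cover relation because no label lies strictly between the two.\<close>

definition bk_swap :: "nat \<Rightarrow> ('a::order \<Rightarrow> nat) \<Rightarrow> 'a \<Rightarrow> nat" where
  "bk_swap j g x =
     (if g x = j \<and> \<not> (\<exists>y>x. g y = Suc j) then Suc j
      else if g x = Suc j \<and> \<not> (\<exists>y<x. g y = j) then j
      else g x)"

lemma strict_mono_bk_swap:
  assumes "strict_mono g"
  shows "strict_mono (bk_swap j g)"
proof (rule strict_monoI)
  fix x y :: 'a
  assume "x < y"
  with assms have "g x < g y" by (simp add: strict_mono_def)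
  with \<open>x < y\<close> show "bk_swap j g x < bk_swap j g y"
    unfolding bk_swap_def by (auto simp: less_Suc_eq)
qed

text \<open>A comparable pair with labels \<open>j\<close> and \<open>Suc j\<close> keeps its labels
  and so stays blocked, while an isolated element stays isolated after the exchange.\<close>

lemma bk_swap_bk_swap:
  assumes "strict_mono g"
  shows "bk_swap j (bk_swap j g) = g"
proof
  fix x
  have mono: "g y < g z" if "y < z" for y z
    using assms that by (simp add: strict_mono_def)
  have low: "bk_swap j g y = j \<longleftrightarrow> (g y = j \<and> (\<exists>z>y. g z = Suc j)) \<or> (g y = Suc j \<and> \<not> (\<exists>z<y. g z = j))" for y
    unfolding bk_swap_def by auto
  have high: "bk_swap j g y = Suc j \<longleftrightarrow> (g y = Suc j \<and> (\<exists>z<y. g z = j)) \<or> (g y = j \<and> \<not> (\<exists>z>y. g z = Suc j))" for y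
    unfolding bk_swap_def by auto
  consider "g x = j" "\<exists>z>x. g z = Suc j" | "g x = j" "\<not> (\<exists>z>x. g z = Suc j)"
    | "g x = Suc j" "\<exists>z<x. g z = j" | "g x = Suc j" "\<not> (\<exists>z<x. g z = j)"
    | "g x \<noteq> j" "g x \<noteq> Suc j" by blast
  then show "bk_swap j (bk_swap j g) x = g x"
  proof cases
    case 1
    then have "\<exists>z>x. bk_swap j g z = Suc j" "bk_swap j g x = j" by (auto simp: high low)
    with 1 show ?thesis by (subst bk_swap_def) auto
  next
    case 2
    \<comment> \<open>The new label \<open>j\<close> comes only from an old \<open>j\<close> or
      \<open>Suc j\<close>, and by monotonicity neither occurs below \<open>x\<close>.\<close>
    then have "\<not> (\<exists>z<x. bk_swap j g z = j)" "bk_swap j g x = Suc j"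
      by (auto simp: high low dest: mono)
    with 2 show ?thesis by (subst bk_swap_def) auto
  next
    case 3
    then have "\<exists>z<x. bk_swap j g z = j" "bk_swap j g x = Suc j" by (auto simp: high low)
    with 3 show ?thesis by (subst bk_swap_def) auto
  next
    case 4
    then have "\<not> (\<exists>z>x. bk_swap j g z = Suc j)" "bk_swap j g x = j"
      by (auto simp: high low dest: mono)
    with 4 show ?thesis by (subst bk_swap_def) auto
  next
    case 5
    then have "bk_swap j g x = g x" by (simp add: bk_swap_def)
    with 5 show ?thesis by (subst bk_swap_def) auto
  qed
qed

text \<open>An element labeled \<open>j\<close> is either free, and then acquires
  \<open>Suc j\<close>, or lies below an element labeled \<open>Suc j\<close>, which then keeps it.
  So \<open>Suc j\<close> survives, and dually \<open>j\<close> does.\<close>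

lemma bk_swap_range_subset:
  assumes "{j, Suc j} \<subseteq> range g"
  shows "range g \<subseteq> range (bk_swap j g)"
proof -
  obtain a b where a: "g a = j" and b: "g b = Suc j"
    using assms by (auto simp: image_iff)
  have hi: "\<exists>x. bk_swap j g x = Suc j"
  proof (cases "\<exists>y>a. g y = Suc j")
    case True
    then obtain y where "y > a" "g y = Suc j" by blast
    then have "bk_swap j g y = Suc j" using a by (auto simp: bk_swap_def)
    then show ?thesis ..
  next
    case False
    then have "bk_swap j g a = Suc j" using a by (auto simp: bk_swap_def)
    then show ?thesis ..
  qed
  have lo: "\<exists>x. bk_swap j g x = j"
  proof (cases "\<exists>y<b. g y = j")
    case True
    then obtain y where "y < b" "g y = j" by blast
    then have "bk_swap j g y = j" using b by (auto simp: bk_swap_def)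
    then show ?thesis ..
  next
    case False
    then have "bk_swap j g b = j" using b by (auto simp: bk_swap_def)
    then show ?thesis ..
  qed
  show ?thesis
  proof
    fix v assume "v \<in> range g"
    then obtain x where x: "v = g x" by blast
    show "v \<in> range (bk_swap j g)"
    proof (cases "v = j \<or> v = Suc j")
      case True
      then show ?thesis using hi lo by (metis rangeI)
    next
      case False
      then have "bk_swap j g x = v" using x by (simp add: bk_swap_def)
      then show ?thesis by blast
    qed
  qed
qed

section \<open>Packed labelings and the factorization of K-promotion\<close>

lemma packed_labelings_iff:
  "L \<in> packed_labelings m \<longleftrightarrow> range L = {1..m} \<and> strict_mono L"
  by (auto simp: packed_labelings_def strict_mono_def)

lemma finite_packed_labelings: "finite (packed_labelings m :: ('a::{finite,order} \<Rightarrow> nat) set)"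
proof (rule finite_subset)
  show "packed_labelings m \<subseteq> {L :: 'a \<Rightarrow> nat. \<forall>x. (x \<in> UNIV \<longrightarrow> L x \<in> {1..m}) \<and> (x \<notin> UNIV \<longrightarrow> L x = 0)}"
    by (auto simp: packed_labelings_def)
  show "finite {L :: 'a \<Rightarrow> nat. \<forall>x. (x \<in> UNIV \<longrightarrow> L x \<in> {1..m}) \<and> (x \<notin> UNIV \<longrightarrow> L x = 0)}"
    by (intro finite_set_of_finite_funs) auto
qed

lemma bk_swap_in_packed_labelings:
  assumes "g \<in> packed_labelings m" "1 \<le> j" "j < m"
  shows "bk_swap j g \<in> packed_labelings m"
proof -
  have r: "range g = {1..m}" and s: "strict_mono g"
    using assms(1) by (auto simp: packed_labelings_iff)
  have "range (bk_swap j g) \<subseteq> {1..m}"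
  proof safe
    fix x
    have "g x \<in> {1..m}" using r by blast
    then show "bk_swap j g x \<in> {1..m}" using assms(2,3) by (auto simp: bk_swap_def)
  qed
  moreover have "{1..m} \<subseteq> range (bk_swap j g)"
    using bk_swap_range_subset[of j g] r assms(2,3) by auto
  ultimately show ?thesis
    using strict_mono_bk_swap[OF s] by (auto simp: packed_labelings_iff)
qed

text \<open>
  Just before the slide of \<open>i + 1\<close>, the unlabeled elements play the role of the label \<open>i\<close>, and
  the labels \<open>2, \<dots>, i\<close> already moved stand for \<open>1, \<dots>, i - 1\<close>.
\<close>
definition slide_state :: "nat \<Rightarrow> ('a \<Rightarrow> nat) \<Rightarrow> 'a \<Rightarrow> nat option" where
  "slide_state i g x =
     (if g x = i then None else if g x < i then Some (Suc (g x)) else Some (g x))"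

text \<open>The two maps move opposite elements: a slide changes the blocked ones,
  \<open>bk_swap\<close> the free ones. They agree because "unlabeled" stands for \<open>i\<close>
  before the slide and for \<open>Suc i\<close> after it.\<close>

lemma slide_slide_state:
  assumes "strict_mono g"
  shows "slide (Suc i) (slide_state i g) = slide_state (Suc i) (bk_swap i g)"
proof
  fix z
  have mono: "g x < g y" if "x < y" for x y
    using assms that by (simp add: strict_mono_def)
  \<comment> \<open>An element strictly between would need a label strictly between \<open>i\<close>
    and \<open>Suc i\<close>.\<close>
  have cov: "covers_in UNIV x y \<longleftrightarrow> x < y" if "g x = i" "g y = Suc i" for x y
    using that by (fastforce simp: covers_in_def dest: mono)
  have none: "slide_state i g x = None \<longleftrightarrow> g x = i" for x
    by (simp add: slide_state_def)
  have some: "slide_state i g x = Some (Suc i) \<longleftrightarrow> g x = Suc i" for x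
    by (auto simp: slide_state_def)
  show "slide (Suc i) (slide_state i g) z = slide_state (Suc i) (bk_swap i g) z"
  proof -
    consider "g z = i" | "g z = Suc i" | "g z \<noteq> i" "g z \<noteq> Suc i" by blast
    then show ?thesis
    proof cases
      case 1
      then have "(\<exists>y. covers_in UNIV z y \<and> g y = Suc i) \<longleftrightarrow> (\<exists>y>z. g y = Suc i)"
        using cov by blast
      then show ?thesis using 1
        unfolding slide_def none some by (auto simp: slide_state_def bk_swap_def)
    next
      case 2
      then have "(\<exists>x. covers_in UNIV x z \<and> g x = i) \<longleftrightarrow> (\<exists>x<z. g x = i)"
        using cov by blast
      then show ?thesis using 2
        unfolding slide_def none some by (auto simp: slide_state_def bk_swap_def)
    next
      case 3
      then show ?thesis
        unfolding slide_def none some by (auto simp: slide_state_def bk_swap_def)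
    qed
  qed
qed

lemma fold_bk_swap_in_packed_labelings:
  assumes "L \<in> packed_labelings m" "set js \<subseteq> {1..<m}"
  shows "fold bk_swap js L \<in> packed_labelings m"
  using assms
proof (induction js arbitrary: L)
  case (Cons j js)
  then have "bk_swap j L \<in> packed_labelings m" by (intro bk_swap_in_packed_labelings) auto
  then show ?case using Cons by simp
qed simp

text \<open>The slide of \<open>Suc i\<close> corresponds to the involution with index
  \<open>i\<close>, whence the shift between the two index lists.\<close>

lemma fold_slide:
  assumes "L \<in> packed_labelings m" "1 \<le> n" "n \<le> m"
  shows "fold slide [2..<Suc n] (slide_state 1 L) = slide_state n (fold bk_swap [1..<n] L)"
  using assms(2,3)
proof (induction n rule: nat_induct_at_least)
  case base
  then show ?case by simp
next
  case (Suc n)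
  have "fold bk_swap [1..<n] L \<in> packed_labelings m"
    using assms(1) Suc by (intro fold_bk_swap_in_packed_labelings) auto
  then have "strict_mono (fold bk_swap [1..<n] L)" by (simp add: packed_labelings_iff)
  then show ?case using Suc by (simp add: slide_slide_state)
qed

lemma K_promotion_eq_fold_bk_swap:
  assumes "L \<in> packed_labelings m" "1 \<le> m"
  shows "K_promotion m L = fold bk_swap [1..<m] L"
proof -
  have bounds: "1 \<le> g x \<and> g x \<le> m" if "g \<in> packed_labelings m" for g and x :: 'a
  proof -
    have "g x \<in> range g" by blast
    with that show ?thesis by (simp add: packed_labelings_iff)
  qed
  have init: "(\<lambda>z. if L z = 1 then None else Some (L z)) = slide_state 1 L"
  proof
    fix z
    show "(if L z = 1 then None else Some (L z)) = slide_state 1 L z"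
      using bounds[OF assms(1), of z] by (simp add: slide_state_def)
  qed
  let ?g = "fold bk_swap [1..<m] L"
  have "?g \<in> packed_labelings m"
    using assms by (intro fold_bk_swap_in_packed_labelings) auto
  then have le: "?g x \<le> m" for x using bounds by blast
  show ?thesis
    unfolding K_promotion_def init Let_def fold_slide[OF assms order_refl]
  proof
    fix z
    \<comment> \<open>Final relabeling inverts \<open>slide_state m\<close>: unlabeled stands for
      \<open>m\<close>, and every smaller label was stored increased by one. The bound
      \<open>le\<close> excludes labels above \<open>m\<close>.\<close>
    show "(case slide_state m ?g z of None \<Rightarrow> m | Some j \<Rightarrow> j - 1) = ?g z"
      using le[of z] by (simp add: slide_state_def)
  qed
qed

lemma fold_bk_swap_inj:
  assumes "L \<in> packed_labelings m" "L' \<in> packed_labelings m" "set js \<subseteq> {1..<m}"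
    and "fold bk_swap js L = fold bk_swap js L'"
  shows "L = L'"
  using assms
proof (induction js arbitrary: L L')
  case (Cons j js)
  then have "bk_swap j L \<in> packed_labelings m" "bk_swap j L' \<in> packed_labelings m"
    by (auto intro: bk_swap_in_packed_labelings)
  with Cons have "bk_swap j L = bk_swap j L'" by simp
  moreover have "strict_mono L" "strict_mono L'"
    using Cons.prems(1,2) by (auto simp: packed_labelings_iff)
  ultimately show ?case by (metis bk_swap_bk_swap)
qed auto

lemma K_promotion_in_packed_labelings:
  assumes "L \<in> packed_labelings m" "1 \<le> m"
  shows "K_promotion m L \<in> packed_labelings m"
  using assms by (auto simp: K_promotion_eq_fold_bk_swap intro!: fold_bk_swap_in_packed_labelings)

lemma bij_betw_K_promotion:
  assumes "1 \<le> m"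
  shows "bij_betw (K_promotion m) (packed_labelings m :: ('a::{finite,order} \<Rightarrow> nat) set) (packed_labelings m)"
proof -
  let ?S = "packed_labelings m :: ('a \<Rightarrow> nat) set"
  have "inj_on (K_promotion m) ?S"
  proof (rule inj_onI)
    fix L L' :: "'a \<Rightarrow> nat"
    assume LL': "L \<in> ?S" "L' \<in> ?S" "K_promotion m L = K_promotion m L'"
    then show "L = L'"
      using fold_bk_swap_inj[OF LL'(1,2), of "[1..<m]"] assms
      by (simp add: K_promotion_eq_fold_bk_swap)
  qed
  moreover have "K_promotion m ` ?S \<subseteq> ?S"
    using assms K_promotion_in_packed_labelings by blast
  ultimately show ?thesis
    by (simp add: bij_betw_def endo_inj_surj finite_packed_labelings)
qed

section \<open>Labels at the minimum, on chains and on branches\<close>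

lemma packed_labelings_bot:
  fixes L :: "'a::order_bot \<Rightarrow> nat"
  assumes "L \<in> packed_labelings m" "1 \<le> m"
  shows "L bot = 1"
proof -
  have "range L = {1..m}" "strict_mono L" using assms(1) by (auto simp: packed_labelings_iff)
  then obtain x where x: "L x = 1" using assms(2) by (metis atLeastAtMost_iff order_refl rangeE)
  have "L bot \<le> L x" using \<open>strict_mono L\<close> by (simp add: strict_mono_mono monoD)
  moreover have "L bot \<in> {1..m}" using \<open>range L = {1..m}\<close> by blast
  ultimately show ?thesis using x by simp
qed

lemma packed_labelings_gt_1:
  fixes L :: "'a::order_bot \<Rightarrow> nat"
  assumes "L \<in> packed_labelings m" "1 \<le> m" "x \<noteq> bot"
  shows "2 \<le> L x"
proof -
  have "L bot < L x" using assms by (simp add: packed_labelings_iff strict_mono_def bot.not_eq_extremum)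
  then show ?thesis using packed_labelings_bot[OF assms(1,2)] by simp
qed

text \<open>Every element labeled 2 lies above \<open>bot\<close>, so it is blocked;
  \<open>bot\<close> is blocked too, because \<open>2 \<le> m\<close> guarantees that the label 2
  occurs.\<close>

lemma bk_swap_1:
  fixes L :: "'a::order_bot \<Rightarrow> nat"
  assumes "L \<in> packed_labelings m" "2 \<le> m"
  shows "bk_swap 1 L = L"
proof
  fix x
  have one: "L bot = 1" using packed_labelings_bot assms by force
  have r: "range L = {1..m}" using assms(1) by (auto simp: packed_labelings_iff)
  have gt: "2 \<le> L y" if "y \<noteq> bot" for y using packed_labelings_gt_1[OF assms(1) _ that] assms(2) by simp
  have "2 \<in> range L" using r assms(2) by simp
  then obtain y where y: "L y = 2" by (metis rangeE)
  then have "bot < y" using one bot.not_eq_extremum by fastforce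
  show "bk_swap 1 L x = L x"
  proof (cases "x = bot")
    case True
    then show ?thesis using one y \<open>bot < y\<close> by (auto simp: bk_swap_def)
  next
    case False
    then have "bot < x" by (simp add: bot.not_eq_extremum)
    then show ?thesis using one gt[OF False] by (auto simp: bk_swap_def)
  qed
qed

lemma inj_on_chain:
  assumes mono: "strict_mono g" and chain: "Complete_Partial_Order.chain (\<le>) B"
  shows "inj_on g B"
  using chain mono unfolding inj_on_def chain_def strict_mono_def
  by (metis less_irrefl order.order_iff_strict)

text \<open>If both labels occur on the chain, their carriers are comparable and stay fixed, and the
  label set is invariant under the transposition. Otherwise \<open>closed\<close> rules out any
  blocking, and the transposition acts pointwise.\<close>

lemma bk_swap_image_chain:
  assumes mono: "strict_mono g" and chain: "Complete_Partial_Order.chain (\<le>) B"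
    and closed: "\<And>x y. x \<in> B \<Longrightarrow> x < y \<or> y < x \<Longrightarrow> g y = j \<or> g y = Suc j \<Longrightarrow> y \<in> B"
  shows "bk_swap j g ` B = transpose j (Suc j) ` (g ` B)"
proof (cases "j \<in> g ` B \<and> Suc j \<in> g ` B")
  case True
  then obtain a b where ab: "a \<in> B" "g a = j" "b \<in> B" "g b = Suc j" by (metis imageE)
  have "a < b"
  proof -
    have "a \<le> b \<or> b \<le> a" using chain ab by (auto simp: chain_def)
    moreover have "\<not> b \<le> a" using ab monoD[OF strict_mono_mono[OF mono], of b a] by auto
    ultimately show ?thesis by (auto simp: less_le)
  qed
  have inj: "x = y" if "x \<in> B" "y \<in> B" "g x = g y" for x y
    using inj_onD[OF inj_on_chain[OF mono chain] that(3,1,2)] .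
  have "bk_swap j g x = g x" if "x \<in> B" for x
    using that inj[of x a] inj[of x b] ab \<open>a < b\<close> by (auto simp: bk_swap_def)
  then have "bk_swap j g ` B = g ` B" by simp
  moreover have "transpose j (Suc j) ` (g ` B) = g ` B"
    using True by (rule_tac transpose_image_eq) simp
  ultimately show ?thesis by simp
next
  case False
  have "bk_swap j g x = transpose j (Suc j) (g x)" if "x \<in> B" for x
  proof -
    have "g y \<noteq> Suc j" if "g x = j" "x < y" for y
      using closed[OF \<open>x \<in> B\<close>, of y] that False \<open>x \<in> B\<close> by (metis imageI)
    moreover have "g y \<noteq> j" if "g x = Suc j" "y < x" for y
      using closed[OF \<open>x \<in> B\<close>, of y] that False \<open>x \<in> B\<close> by (metis imageI)
    ultimately show ?thesis by (auto simp: bk_swap_def transpose_def)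
  qed
  then show ?thesis by (simp add: image_image)
qed

text \<open>Induction on the number of elements strictly between: an interval that is not a cover
  splits at an inner element, which is again different from \<open>bot\<close>.\<close>

lemma hasse_adj_connected:
  fixes x y :: "'a::{finite,order_bot}"
  assumes "x < y" "x \<noteq> bot"
  shows "(x, y) \<in> (hasse_adj (- {bot}))\<^sup>*"
  using assms
proof (induction "card {x<..<y}" arbitrary: x y rule: less_induct)
  case less
  have y: "y \<noteq> bot" using less.prems by auto
  show ?case
  proof (cases "covers_in (- {bot}) x y")
    case True
    then show ?thesis by (auto simp: hasse_adj_def)
  next
    case False
    then obtain z where z: "x < z" "z < y" "z \<noteq> bot"
      using less.prems y by (auto simp: covers_in_def)
    have "card {x<..<z} < card {x<..<y}" "card {z<..<y} < card {x<..<y}"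
      using z by (auto intro!: psubset_card_mono)
    then show ?thesis using less.hyps z less.prems by (meson rtrancl_trans)
  qed
qed

lemma sym_hasse_adj: "sym (hasse_adj A)"
  by (auto simp: hasse_adj_def sym_def)

lemma bot_notin_principal_subposet:
  fixes B :: "'a::order_bot set"
  assumes "B \<in> principal_subposets"
  shows "bot \<notin> B"
proof -
  let ?r = "(hasse_adj (- {bot :: 'a}))\<^sup>*"
  obtain a where a: "a \<noteq> bot" "B = ?r `` {a}"
    using assms(1) by (auto simp: principal_subposets_def quotient_def)
  have "b \<noteq> bot" if "(a, b) \<in> ?r" for b
    using that a(1) by (induction) (auto simp: hasse_adj_def covers_in_def)
  then show ?thesis using a by auto
qed

text \<open>This isolates a branch from the rest: apart from \<open>bot\<close>, nothing outside it
  can block a label exchange on it.\<close>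

lemma principal_subposet_closed:
  fixes B :: "'a::{finite,order_bot} set"
  assumes "B \<in> principal_subposets" "x \<in> B" "y \<noteq> bot" "x < y \<or> y < x"
  shows "y \<in> B"
proof -
  let ?r = "(hasse_adj (- {bot :: 'a}))\<^sup>*"
  obtain a where a: "a \<noteq> bot" "B = ?r `` {a}"
    using assms(1) by (auto simp: principal_subposets_def quotient_def)
  have "(a, x) \<in> ?r" using a assms(2) by blast
  moreover have "x \<noteq> bot" using bot_notin_principal_subposet[OF assms(1)] assms(2) by blast
  then have "(x, y) \<in> ?r"
    using assms(3,4) hasse_adj_connected sym_rtrancl[OF sym_hasse_adj] by (metis symD)
  ultimately show ?thesis using a by (meson Image_singleton_iff rtrancl_trans)
qed

lemma branch_labels_subset:
  fixes B :: "'a::order_bot set"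
  assumes "L \<in> packed_labelings m" "B \<in> principal_subposets" "1 \<le> m"
  shows "L ` B \<subseteq> {2..m}"
proof safe
  fix b assume "b \<in> B"
  then have "2 \<le> L b"
    using packed_labelings_gt_1[OF assms(1,3)] bot_notin_principal_subposet[OF assms(2)] by metis
  moreover have "L b \<in> {1..m}" using assms(1) by (auto simp: packed_labelings_iff)
  ultimately show "L b \<in> {2..m}" by simp
qed

section \<open>Rotation of the branch labels\<close>

text \<open>This is the cycle on \<open>{2..n}\<close> obtained by applying the transpositions of 2
  and 3, of 3 and 4, up to \<open>n - 1\<close> and \<open>n\<close>, in this order.\<close>

definition rot :: "nat \<Rightarrow> nat \<Rightarrow> nat" where
  "rot n v = (if v = 2 then n else if 2 < v \<and> v \<le> n then v - 1 else v)"

lemma inj_on_rot: "inj_on (rot m) {2..m}"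
  by (auto simp: inj_on_def rot_def split: if_splits)

lemma transpose_rot: "2 \<le> n \<Longrightarrow> 2 \<le> v \<Longrightarrow> transpose n (Suc n) (rot n v) = rot (Suc n) v"
  by (auto simp: rot_def transpose_def)

lemma K_promotion_image_branch:
  fixes B :: "'a::{finite,order_bot} set"
  assumes L: "L \<in> packed_labelings m" and B: "is_branch B" and m: "2 \<le> m"
  shows "K_promotion m L ` B = rot m ` (L ` B)"
proof -
  have prin: "B \<in> principal_subposets" and chain: "Complete_Partial_Order.chain (\<le>) B"
    using B by (auto simp: is_branch_def)
  have ge2: "2 \<le> L b" if "b \<in> B" for b
    using branch_labels_subset[OF L prin] m that by auto
  \<comment> \<open>Induction over the partial products, starting at index 2 because the involution
    with index 1 is trivial.\<close>
  have "fold bk_swap [2..<n] L ` B = rot n ` (L ` B)" if "2 \<le> n" "n \<le> m" for n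
    using that
  proof (induction n rule: nat_induct_at_least)
    case base
    have "rot 2 v = v" for v by (simp add: rot_def)
    then show ?case by simp
  next
    case (Suc n)
    let ?g = "fold bk_swap [2..<n] L"
    have g: "?g \<in> packed_labelings m"
      using L Suc by (intro fold_bk_swap_in_packed_labelings) auto
    then have mono: "strict_mono ?g" by (simp add: packed_labelings_iff)
    have bot: "?g bot = 1" using packed_labelings_bot[OF g] m by simp
    have "fold bk_swap [2..<Suc n] L ` B = bk_swap n ?g ` B"
      using Suc by simp
    also have "\<dots> = transpose n (Suc n) ` (?g ` B)"
    proof (rule bk_swap_image_chain[OF mono chain])
      fix x y assume "x \<in> B" "x < y \<or> y < x" "?g y = n \<or> ?g y = Suc n"
      \<comment> \<open>The label of \<open>bot\<close> is 1, whereas \<open>n\<close> is at least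
        2.\<close>
      moreover from this have "y \<noteq> bot" using bot Suc by auto
      ultimately show "y \<in> B" using principal_subposet_closed[OF prin] by blast
    qed
    also have "\<dots> = rot (Suc n) ` (L ` B)"
      using Suc ge2 by (auto simp: image_image transpose_rot intro!: image_cong)
    finally show ?case .
  qed
  moreover have "K_promotion m L = fold bk_swap [2..<m] L"
  proof -
    have "[1..<m] = 1 # [2..<m]" using m by (simp add: upt_conv_Cons numeral_2_eq_2)
    then show ?thesis
      using K_promotion_eq_fold_bk_swap[OF L] m bk_swap_1[OF L m] by simp
  qed
  ultimately show ?thesis using m by simp
qed

text \<open>The jump from 2 to \<open>m\<close> also lowers the label by one modulo
  \<open>m - 1\<close>, since 1 and \<open>m\<close> are congruent.\<close>

lemma rot_mod:
  assumes "2 \<le> v" "v \<le> m"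
  shows "int (rot m v) mod int (m - 1) = (int v - 1) mod int (m - 1)"
  using assms by (auto simp: rot_def mod_eq_dvd_iff of_nat_diff)

lemma K_promotion_sum_branch:
  fixes B :: "'a::{finite,order_bot} set"
  assumes L: "L \<in> packed_labelings m" and B: "is_branch B" and m: "2 \<le> m"
  shows "(\<Sum>v\<in>K_promotion m L ` B. int v) mod int (m - 1)
    = ((\<Sum>v\<in>L ` B. int v) - int (card B)) mod int (m - 1)"
proof -
  have prin: "B \<in> principal_subposets" and chain: "Complete_Partial_Order.chain (\<le>) B"
    using B by (auto simp: is_branch_def)
  have mono: "strict_mono L" using L by (auto simp: packed_labelings_iff)
  have sub: "L ` B \<subseteq> {2..m}" using branch_labels_subset[OF L prin] m by simp
  have "(\<Sum>v\<in>K_promotion m L ` B. int v) = (\<Sum>v\<in>L ` B. int (rot m v))"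
    using inj_on_subset[OF inj_on_rot sub]
    by (simp add: K_promotion_image_branch[OF L B m] sum.reindex)
  also have "\<dots> mod int (m - 1) = (\<Sum>v\<in>L ` B. int (rot m v) mod int (m - 1)) mod int (m - 1)"
    by (simp add: mod_sum_eq)
  also have "\<dots> = (\<Sum>v\<in>L ` B. (int v - 1) mod int (m - 1)) mod int (m - 1)"
  proof -
    have "int (rot m v) mod int (m - 1) = (int v - 1) mod int (m - 1)" if "v \<in> L ` B" for v
      using that sub by (intro rot_mod) auto
    then show ?thesis by (metis (no_types, lifting) sum.cong)
  qed
  also have "\<dots> = (\<Sum>v\<in>L ` B. int v - 1) mod int (m - 1)"
    by (simp add: mod_sum_eq)
  also have "(\<Sum>v\<in>L ` B. int v - 1) = (\<Sum>v\<in>L ` B. int v) - int (card B)"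
    using card_image[OF inj_on_chain[OF mono chain]] by (simp add: sum_subtractf)
  finally show ?thesis .
qed

text \<open>The labels \<open>2, ..., m\<close> represent each class modulo \<open>m - 1\<close>
  exactly once, so this views the branch labels as a subset of the integers modulo
  \<open>n = m - 1\<close>, which promotion translates by -1.\<close>

definition residue_mem :: "nat \<Rightarrow> 'a set \<Rightarrow> ('a \<Rightarrow> nat) \<Rightarrow> int \<Rightarrow> bool" where
  "residue_mem n B L x \<longleftrightarrow> (\<exists>v\<in>L ` B. int v mod int n = x mod int n)"

lemma residue_mem_K_promotion:
  fixes B :: "'a::{finite,order_bot} set"
  assumes L: "L \<in> packed_labelings m" and B: "is_branch B" and m: "2 \<le> m"
  shows "residue_mem (m - 1) B (K_promotion m L) x \<longleftrightarrow> residue_mem (m - 1) B L (x + 1)"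
proof -
  have prin: "B \<in> principal_subposets" using B by (auto simp: is_branch_def)
  have "int (rot m (L b)) mod int (m - 1) = x mod int (m - 1)
      \<longleftrightarrow> int (L b) mod int (m - 1) = (x + 1) mod int (m - 1)" if "b \<in> B" for b
  proof -
    have "L b \<in> {2..m}" using branch_labels_subset[OF L prin] m that by auto
    then have "int (rot m (L b)) mod int (m - 1) = (int (L b) - 1) mod int (m - 1)"
      by (intro rot_mod) auto
    also have "\<dots> = x mod int (m - 1) \<longleftrightarrow> int (L b) mod int (m - 1) = (x + 1) mod int (m - 1)"
      unfolding mod_eq_dvd_iff by (simp add: algebra_simps)
    finally show ?thesis .
  qed
  then show ?thesis
    by (auto simp: residue_mem_def K_promotion_image_branch[OF L B m])
qed

section \<open>Ranks in chains and a labeling with an interval on the branch\<close>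

text \<open>The size of the down-set is the rank in the chain. It serves to renumber both the branch
  and a set of labels without gaps.\<close>

lemma chain_rank_image:
  fixes A :: "'a::order set"
  assumes "finite A" "Complete_Partial_Order.chain (\<le>) A"
  shows "(\<lambda>x. card {y \<in> A. y \<le> x}) ` A = {1..card A}"
proof (rule card_subset_eq)
  let ?r = "\<lambda>x. card {y \<in> A. y \<le> x}"
  show "?r ` A \<subseteq> {1..card A}"
  proof safe
    fix x assume "x \<in> A"
    have "card {x} \<le> ?r x" using \<open>x \<in> A\<close> assms(1) by (intro card_mono) auto
    moreover have "?r x \<le> card A" using assms(1) by (intro card_mono) auto
    ultimately show "?r x \<in> {1..card A}" by simp
  qed
  have "inj_on ?r A"
  proof (rule inj_onI)
    fix x y assume xy: "x \<in> A" "y \<in> A" "?r x = ?r y"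
    have "x \<le> y \<or> y \<le> x" using assms(2) xy by (auto simp: chain_def)
    then have "{z \<in> A. z \<le> x} = {z \<in> A. z \<le> y}"
    proof
      assume "x \<le> y"
      then show ?thesis using assms(1) xy(3) by (intro card_subset_eq) auto
    next
      assume "y \<le> x"
      then show ?thesis
        using assms(1) xy(3) by (intro card_subset_eq[symmetric]) auto
    qed
    then show "x = y" using xy by (auto intro: order_antisym)
  qed
  then show "card (?r ` A) = card {1..card A}" by (simp add: card_image)
qed simp

lemma chain_rank_less:
  fixes A :: "'a::order set"
  assumes "finite A" "y \<in> A" "x < y"
  shows "card {z \<in> A. z \<le> x} < card {z \<in> A. z \<le> y}"
proof (rule psubset_card_mono)
  have "{z \<in> A. z \<le> x} \<subseteq> {z \<in> A. z \<le> y}" using assms(3) by auto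
  moreover have "y \<in> {z \<in> A. z \<le> y} - {z \<in> A. z \<le> x}" using assms(2,3) by auto
  ultimately show "{z \<in> A. z \<le> x} \<subset> {z \<in> A. z \<le> y}" by blast
qed (use assms(1) in simp)

text \<open>
  Pushing the branch labels down to an initial interval and all other labels up to a final one
  keeps the labeling surjective, because the branch is comparable only to itself and the minimum.
\<close>
lemma packed_labeling_interval_on_branch:
  fixes B :: "'a::{finite,order_bot} set" and L0 :: "'a \<Rightarrow> nat"
  assumes L0: "L0 \<in> packed_labelings m" and B: "is_branch B" and m: "card B + 2 \<le> m"
  obtains L where "L \<in> packed_labelings m" "L ` B = {2..Suc (card B)}"
proof -
  have prin: "B \<in> principal_subposets" and chain: "Complete_Partial_Order.chain (\<le>) B"
    using B by (auto simp: is_branch_def)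
  have bot: "bot \<notin> B" using bot_notin_principal_subposet[OF prin] .
  have r0: "range L0 = {1..m}" and mono0: "strict_mono L0"
    using L0 by (auto simp: packed_labelings_iff)
  define R where "R = - insert bot B"
  define T where "T = L0 ` R"
  \<comment> \<open>The branch is numbered by rank from 2 on; the other labels keep their relative
    order and are compressed into the top \<open>card T\<close> values.\<close>
  define L where "L x = (if x = bot then 1
    else if x \<in> B then Suc (card {b \<in> B. b \<le> x})
    else m - card T + card {v \<in> T. v \<le> L0 x})" for x
  have finT: "finite T" by (simp add: T_def)
  have T2: "T \<subseteq> {2..m}"
  proof
    fix v assume "v \<in> T"
    then obtain x where x: "x \<noteq> bot" "v = L0 x" by (auto simp: T_def R_def)
    then have "2 \<le> v" using packed_labelings_gt_1[OF L0] m by simp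
    moreover have "v \<in> {1..m}" using r0 x by blast
    ultimately show "v \<in> {2..m}" by simp
  qed
  then have cT: "card T \<le> m - 1"
    using card_mono[OF _ T2] by simp
  have imB: "L ` B = {2..Suc (card B)}"
  proof -
    have "L ` B = Suc ` (\<lambda>x. card {b \<in> B. b \<le> x}) ` B"
      using bot by (auto simp: L_def image_image intro!: image_cong)
    also have "\<dots> = {2..Suc (card B)}"
      by (simp add: chain_rank_image[OF _ chain] image_Suc_atLeastAtMost numeral_2_eq_2)
    finally show ?thesis .
  qed
  have imR: "L ` R = {m - card T + 1..m}"
  proof -
    have "L ` R = (+) (m - card T) ` (\<lambda>w. card {v \<in> T. v \<le> w}) ` T"
      unfolding T_def[symmetric] by (auto simp: L_def R_def T_def image_image intro!: image_cong)
    also have "\<dots> = (+) (m - card T) ` {1..card T}"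
      using chain_rank_image[OF finT] by (auto simp: chain_def linorder_linear)
    also have "\<dots> = {m - card T + 1..m}"
      using cT m by (simp only: image_add_atLeastAtMost) simp
    finally show ?thesis .
  qed
  have eq: "{1..m} = insert 1 (L0 ` B \<union> T)"
  proof -
    have "UNIV = insert bot (B \<union> R)" by (auto simp: R_def)
    then have "range L0 = L0 ` insert bot (B \<union> R)" by simp
    then show ?thesis using r0 packed_labelings_bot[OF L0] m by (simp add: T_def image_Un)
  qed
  \<comment> \<open>The labels of \<open>L0\<close> are exhausted by 1, those on \<open>B\<close>
    and those in \<open>T\<close>. Hence the two new intervals, which may overlap, leave no
    gap.\<close>
  have "m \<le> Suc (card B + card T)"
  proof -
    have "m = card (insert 1 (L0 ` B \<union> T))" using eq by (metis card_atLeastAtMost diff_Suc_1)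
    also have "\<dots> \<le> Suc (card (L0 ` B \<union> T))" by (simp add: card_insert_le_m1 card_insert_if finT)
    also have "\<dots> \<le> Suc (card (L0 ` B) + card T)" by (simp add: card_Un_le)
    also have "\<dots> \<le> Suc (card B + card T)" by (simp add: card_image_le)
    finally show ?thesis .
  qed
  moreover have "range L = insert 1 (L ` B \<union> L ` R)"
  proof -
    have "UNIV = insert bot (B \<union> R)" by (auto simp: R_def)
    then have "range L = L ` insert bot (B \<union> R)" by simp
    moreover have "L bot = 1" by (simp add: L_def)
    ultimately show ?thesis by (simp add: image_Un)
  qed
  ultimately have "range L = {1..m}" using imB imR m cT by auto
  moreover have "strict_mono L"
  proof (rule strict_monoI)
    fix x y :: 'a assume "x < y"
    then have y: "y \<noteq> bot" by auto
    show "L x < L y"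
    proof (cases "x = bot")
      case True
      have "y \<in> B \<or> y \<in> R" using y by (auto simp: R_def)
      then have "L y \<in> {2..Suc (card B)} \<or> L y \<in> {m - card T + 1..m}"
        using imB imR by blast
      then have "2 \<le> L y" using cT m by auto
      then show ?thesis using True by (simp add: L_def)
    next
      case False
      then have "x \<in> B \<longleftrightarrow> y \<in> B"
        using principal_subposet_closed[OF prin] y \<open>x < y\<close> by blast
      moreover have "L0 x < L0 y" using mono0 \<open>x < y\<close> by (simp add: strict_mono_def)
      moreover have "L0 y \<in> T" if "y \<notin> B" using that y by (auto simp: T_def R_def)
      ultimately show ?thesis
        using False y \<open>x < y\<close> chain_rank_less[of B y x] chain_rank_less[of T "L0 y" "L0 x"] finT
        by (auto simp: L_def)
    qed
  qed
  ultimately have "L \<in> packed_labelings m" by (simp add: packed_labelings_iff)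
  then show ?thesis using imB that by blast
qed

section \<open>Group action, orbits and the order of promotion\<close>

lemma BijGroup_pow_apply:
  assumes "f \<in> Bij S" "x \<in> S"
  shows "(f [^]\<^bsub>BijGroup S\<^esub> (n::nat)) x = (f ^^ n) x"
  using assms(2)
proof (induction n arbitrary: x)
  case 0
  then show ?case by (simp add: BijGroup_def)
next
  case (Suc n)
  interpret group "BijGroup S" by (rule group_BijGroup)
  have f: "f \<in> carrier (BijGroup S)" using assms(1) by (simp add: BijGroup_def)
  have "f [^]\<^bsub>BijGroup S\<^esub> n \<in> Bij S"
    using nat_pow_closed[OF f] by (simp add: BijGroup_def)
  moreover have "f x \<in> S" using Bij_imp_funcset[OF assms(1)] Suc.prems by blast
  moreover have "g \<otimes>\<^bsub>BijGroup S\<^esub> f = compose S g f" if "g \<in> Bij S" for g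
    using that assms(1) by (simp add: BijGroup_def)
  \<comment> \<open>The group power adds its new factor on the right, so \<open>f\<close> acts
    first; \<open>funpow_swap1\<close> reconciles this with \<open>^^\<close>.\<close>
  ultimately show ?case
    using Suc by (simp add: compose_eq funpow_swap1)
qed

lemma K_promotion_perm_in_Bij:
  assumes "1 \<le> m"
  shows "K_promotion_perm m \<in> Bij (packed_labelings m :: ('a::{finite,order} \<Rightarrow> nat) set)"
  using bij_betw_K_promotion[OF assms]
  by (simp add: Bij_def K_promotion_perm_def)

text \<open>Left multiplication by the generator maps an orbit into itself; injectivity and
  finiteness turn the inclusion into equality.\<close>

lemma K_promotion_orbit_image:
  fixes X :: "('a::{finite,order} \<Rightarrow> nat) set"
  assumes "1 \<le> m" "X \<in> K_promotion_orbits m"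
  shows "X \<subseteq> packed_labelings m" "inj_on (K_promotion m) X" "K_promotion m ` X = X"
proof -
  let ?S = "packed_labelings m :: ('a \<Rightarrow> nat) set"
  let ?f = "K_promotion_perm m :: ('a \<Rightarrow> nat) \<Rightarrow> ('a \<Rightarrow> nat)"
  let ?C = "carrier (subgroup_generated (BijGroup ?S) {?f})"
  interpret group "BijGroup ?S" by (rule group_BijGroup)
  have f: "?f \<in> Bij ?S" using K_promotion_perm_in_Bij[OF assms(1)] .
  obtain L where L: "L \<in> ?S" "X = {g L | g. g \<in> ?C}"
    using assms(2) by (auto simp: K_promotion_orbits_def orbits_def orbit_def)
  have sub: "?C \<subseteq> Bij ?S"
    using carrier_subgroup_generated_subset[of "{?f}"] by (simp add: BijGroup_def)
  show XS: "X \<subseteq> ?S"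
    using L sub Bij_imp_funcset by blast
  show inj: "inj_on (K_promotion m) X"
    using bij_betw_K_promotion[OF assms(1)] XS by (meson bij_betw_def inj_on_subset)
  have fin: "finite X" using XS finite_packed_labelings finite_subset by blast
  have "K_promotion m ` X \<subseteq> X"
  proof safe
    fix L' assume L': "L' \<in> X"
    then obtain g where g: "g \<in> ?C" "L' = g L" using L by blast
    have "?f \<in> ?C" using f by (auto simp: carrier_subgroup_generated BijGroup_def intro: generate.incl)
    then have "?f \<otimes>\<^bsub>BijGroup ?S\<^esub> g \<in> ?C"
      using g(1) unfolding carrier_subgroup_generated by (rule generate.eng)
    moreover have "(?f \<otimes>\<^bsub>BijGroup ?S\<^esub> g) L = K_promotion m L'"
      using f g sub L XS L' by (auto simp: BijGroup_def compose_def K_promotion_perm_def)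
    ultimately show "K_promotion m L' \<in> X" using L(2) by force
  qed
  then show "K_promotion m ` X = X" using endo_inj_surj[OF fin _ inj] by blast
qed

text \<open>
  Promotion permutes the orbit, so summing the congruence for the branch sum over the orbit
  cancels the branch sums and leaves \<open>m - 1\<close> dividing \<open>card X * card B\<close>.
\<close>
lemma dvd_card_K_promotion_orbit:
  fixes B :: "'a::{finite,order_bot} set" and X :: "('a \<Rightarrow> nat) set"
  assumes m: "2 \<le> m" and B: "is_branch B" and X: "X \<in> K_promotion_orbits m"
    and "coprime (card B) (m - 1)"
  shows "(m - 1) dvd card X"
proof -
  define c where "c L = (\<Sum>v\<in>L ` B. int v)" for L :: "'a \<Rightarrow> nat"
  have m1: "1 \<le> m" using m by simp
  note orb = K_promotion_orbit_image[OF m1 X]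
  have "(\<Sum>L\<in>X. c L) = (\<Sum>L\<in>X. c (K_promotion m L))"
    using sum.reindex[OF orb(2), of c] orb(3) by simp
  also have "\<dots> mod int (m - 1) = (\<Sum>L\<in>X. c (K_promotion m L) mod int (m - 1)) mod int (m - 1)"
    by (simp add: mod_sum_eq)
  also have "\<dots> = (\<Sum>L\<in>X. (c L - int (card B)) mod int (m - 1)) mod int (m - 1)"
  proof -
    have "c (K_promotion m L) mod int (m - 1) = (c L - int (card B)) mod int (m - 1)" if "L \<in> X" for L
      unfolding c_def using K_promotion_sum_branch[OF _ B m] that orb(1) by blast
    then show ?thesis by simp
  qed
  also have "\<dots> = ((\<Sum>L\<in>X. c L) - int (card X) * int (card B)) mod int (m - 1)"
    by (simp add: mod_sum_eq sum_subtractf)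
  finally have "int (m - 1) dvd int (card X * card B)"
    by (simp add: mod_eq_dvd_iff)
  then have "(m - 1) dvd card X * card B" by (simp only: int_dvd_int_iff)
  then show ?thesis using assms(4) by (simp add: coprime_commute coprime_dvd_mult_left_iff)
qed

text \<open>Membership is carried through the induction because \<open>K_promotion_perm\<close>
  agrees with \<open>K_promotion\<close> only on packed labelings.\<close>

lemma residue_mem_funpow:
  fixes B :: "'a::{finite,order_bot} set"
  assumes L: "L \<in> packed_labelings m" and B: "is_branch B" and m: "2 \<le> m"
  shows "(K_promotion_perm m ^^ n) L \<in> packed_labelings m \<and>
    residue_mem (m - 1) B ((K_promotion_perm m ^^ n) L) x = residue_mem (m - 1) B L (x + int n)"
proof (induction n arbitrary: x)
  case 0
  then show ?case using L by simp
next
  case (Suc n)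
  let ?L = "(K_promotion_perm m ^^ n) L"
  have "?L \<in> packed_labelings m" using Suc by blast
  moreover have "(K_promotion_perm m ^^ Suc n) L = K_promotion m ?L"
    using \<open>?L \<in> packed_labelings m\<close> by (simp add: K_promotion_perm_def[of m, THEN fun_cong])
  ultimately show ?case
    using Suc.IH[of "x + 1"] residue_mem_K_promotion[OF _ B m, of ?L] K_promotion_in_packed_labelings[of ?L m] m
    by (simp add: algebra_simps)
qed

text \<open>
  Modulo \<open>m - 1\<close> a proper interval contains exactly one element whose predecessor is
  missing, so only the trivial rotation preserves it.
\<close>
lemma dvd_ord_K_promotion_perm:
  fixes B :: "'a::{finite,order_bot} set" and L0 :: "'a \<Rightarrow> nat"
  assumes L0: "L0 \<in> packed_labelings m" and B: "is_branch B" and k: "1 \<le> card B" "card B + 2 \<le> m"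
  shows "(m - 1) dvd group.ord (BijGroup (packed_labelings m :: ('a \<Rightarrow> nat) set)) (K_promotion_perm m)"
proof -
  let ?S = "packed_labelings m :: ('a \<Rightarrow> nat) set"
  let ?f = "K_promotion_perm m :: ('a \<Rightarrow> nat) \<Rightarrow> ('a \<Rightarrow> nat)"
  interpret group "BijGroup ?S" by (rule group_BijGroup)
  let ?n = "ord ?f"
  have m: "2 \<le> m" using k by simp
  obtain L where L: "L \<in> ?S" "L ` B = {2..Suc (card B)}"
    using packed_labeling_interval_on_branch[OF L0 B k(2)] .
  have f: "?f \<in> Bij ?S" using K_promotion_perm_in_Bij[of m] m by simp
  then have "?f [^]\<^bsub>BijGroup ?S\<^esub> ?n = \<one>\<^bsub>BijGroup ?S\<^esub>"
    by (intro pow_ord_eq_1) (simp add: BijGroup_def)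
  then have "(?f ^^ ?n) L = L"
    using BijGroup_pow_apply[OF f L(1), of ?n] L(1) by (simp add: BijGroup_def)
  then have per: "residue_mem (m - 1) B L x = residue_mem (m - 1) B L (x + int ?n)" for x
    using residue_mem_funpow[OF L(1) B m, of ?n x] by simp
  define M where "M = int (m - 1)"
  have M: "int (card B) < M" using k by (simp add: M_def)
  \<comment> \<open>The interval of labels starts at 2, so subtracting 2 moves it to the residues
    \<open>0, ..., card B - 1\<close>; these are distinct modulo \<open>M\<close> because
    \<open>card B < M\<close>.\<close>
  have mem: "residue_mem (m - 1) B L x \<longleftrightarrow> (x - 2) mod M < int (card B)" for x
  proof
    assume "residue_mem (m - 1) B L x"
    then obtain v where v: "v \<in> {2..Suc (card B)}" "int v mod M = x mod M"
      by (auto simp: residue_mem_def L(2) M_def)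
    then have "(x - 2) mod M = (int v - 2) mod M" by (metis mod_diff_left_eq)
    also have "\<dots> = int v - 2" using v M by (intro mod_pos_pos_trivial) auto
    finally show "(x - 2) mod M < int (card B)" using v by auto
  next
    assume less: "(x - 2) mod M < int (card B)"
    define v where "v = nat ((x - 2) mod M + 2)"
    have nonneg: "0 \<le> (x - 2) mod M" using M by simp
    then have "v \<in> {2..Suc (card B)}" using less by (auto simp: v_def)
    moreover have "int v mod M = x mod M"
    proof -
      have "int v mod M = ((x - 2) mod M + 2) mod M" using nonneg by (simp add: v_def)
      also have "\<dots> = x mod M" by (simp add: mod_add_left_eq)
      finally show ?thesis .
    qed
    ultimately show "residue_mem (m - 1) B L x"
      unfolding residue_mem_def L(2) M_def by blast
  qed
  \<comment> \<open>The class of 2 occurs on the branch, so by periodicity the class of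
    \<open>2 + int ?n\<close> does too.\<close>
  have lt: "int ?n mod M < int (card B)"
    using per[of 2] mem[of 2] mem[of "2 + int ?n"] k M by simp
  \<comment> \<open>The class of 1, just before the interval, has shifted residue
    \<open>M - 1\<close> and is missing; so is its translate.\<close>
  have nlt: "\<not> (int ?n - 1) mod M < int (card B)"
  proof -
    have "(- 1) mod M = M - 1" using M k by (simp add: zmod_minus1)
    then show ?thesis using per[of 1] mem[of 1] mem[of "1 + int ?n"] M by simp
  qed
  have "int ?n mod M = 0"
  proof (rule ccontr)
    assume "int ?n mod M \<noteq> 0"
    moreover have "0 \<le> int ?n mod M" using M by simp
    ultimately have "0 < int ?n mod M" by linarith
    \<comment> \<open>A positive residue below \<open>card B\<close> would have its predecessor
      below \<open>card B\<close> as well, contrary to \<open>nlt\<close>.\<close>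
    then have "(int ?n mod M - 1) mod M = int ?n mod M - 1"
      using lt M by (intro mod_pos_pos_trivial) auto
    then have "(int ?n - 1) mod M = int ?n mod M - 1" by (simp add: mod_diff_left_eq)
    then show False using lt nlt by simp
  qed
  then have "M dvd int ?n" by (simp add: dvd_eq_mod_eq_0)
  then show ?thesis unfolding M_def by (simp only: int_dvd_int_iff)
qed

theorem theorem2p4:
  fixes B :: "'a :: {finite, order_bot} set" and m k :: nat
  assumes "m \<ge> 1"
    and "(packed_labelings m :: ('a \<Rightarrow> nat) set) \<noteq> {}"
    and "is_branch B" and "card B = k"
    and "1 \<le> k" and "k + 2 \<le> m"
  shows "(m - 1) dvd group.ord (BijGroup (packed_labelings m :: ('a \<Rightarrow> nat) set)) (K_promotion_perm m)
    \<and> (gcd k (m - 1) = 1 \<longrightarrow>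
         (\<forall>X \<in> (K_promotion_orbits m :: ('a \<Rightarrow> nat) set set). (m - 1) dvd card X))"
proof (intro conjI impI ballI)
  obtain L0 :: "'a \<Rightarrow> nat" where "L0 \<in> packed_labelings m" using assms(2) by blast
  then show "(m - 1) dvd group.ord (BijGroup (packed_labelings m :: ('a \<Rightarrow> nat) set)) (K_promotion_perm m)"
    using dvd_ord_K_promotion_perm assms(3-6) by blast
next
  fix X :: "('a \<Rightarrow> nat) set"
  assume "gcd k (m - 1) = 1" "X \<in> K_promotion_orbits m"
  then show "(m - 1) dvd card X"
    using dvd_card_K_promotion_orbit[of m B X] assms(3-6) by (simp add: coprime_iff_gcd_eq_1)
qed

end
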